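(* There exist two topological symplectic manifolds that are homeomorphic but not symplectically homeomorphic.
   Context: A symplectic homeomorphism between open subsets of $\mathbb{R}^{2n}$ (with the standard symplectic form) is a homeomorphism which is locally the $C^0$-limit of symplectic diffeomorphisms (i.e. each point of the domain has a neighborhood on which the map is a uniform limit of symplectic diffeomorphisms onto open subsets of $\mathbb{R}^{2n}$). A topological symplectic manifold is a topological $2n$-manifold with an atlas of charts to $\mathbb{R}^{2n}$ whose transition maps are symplectic homeomorphisms; a topological symplectic chart is a chart whose transition maps with the charts of this atlas are symplectic homeomorphisms. A homeomorphism between two topological symplectic manifolds is called a symplectic homeomorphism if it takes every topological symplectic chart to a topological symplectic chart; two topological symplectic manifolds are symplectically homeomorphic if there is a symplectic homeomorphism between them. *)

theory Defs
  imports "HOL-Analysis.Analysis"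
begin

text \<open>
  Since \<open>n\<close> is bound inside the statement, \<open>\<real>\<^sup>2\<^sup>n\<close> is the abstract topology
  \<^term>\<open>Euclidean_space (2 * n)\<close>, whose points are the \<open>x :: nat \<Rightarrow> real\<close> with
  \<open>x i = 0\<close> for all \<open>i \<ge> 2 * n\<close>. The sets \<open>U\<close> below are meant to be open in this topology.
\<close>

subsection \<open>Smooth maps between open subsets of Euclidean space\<close>

definition partial_deriv :: "nat \<Rightarrow> ((nat \<Rightarrow> real) \<Rightarrow> real) \<Rightarrow> (nat \<Rightarrow> real) \<Rightarrow> real"
  where "partial_deriv i f x = deriv (\<lambda>t. f (x(i := t))) (x i)"

primrec Ck_on :: "nat \<Rightarrow> nat \<Rightarrow> ((nat \<Rightarrow> real) \<Rightarrow> real) \<Rightarrow> (nat \<Rightarrow> real) set \<Rightarrow> bool"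
  where
    "Ck_on d 0 f U \<longleftrightarrow> continuous_map (subtopology (Euclidean_space d) U) euclideanreal f"
  | "Ck_on d (Suc k) f U \<longleftrightarrow>
       continuous_map (subtopology (Euclidean_space d) U) euclideanreal f \<and>
       (\<forall>i<d. (\<forall>x\<in>U. (\<lambda>t. f (x(i := t))) field_differentiable at (x i)) \<and>
              Ck_on d k (partial_deriv i f) U)"

definition smooth_map_on ::
    "nat \<Rightarrow> ((nat \<Rightarrow> real) \<Rightarrow> (nat \<Rightarrow> real)) \<Rightarrow> (nat \<Rightarrow> real) set \<Rightarrow> bool"
  where "smooth_map_on d f U \<longleftrightarrow> (\<forall>j<d. \<forall>k. Ck_on d k (\<lambda>x. f x j) U)"

definition differential ::
    "nat \<Rightarrow> ((nat \<Rightarrow> real) \<Rightarrow> (nat \<Rightarrow> real)) \<Rightarrow> (nat \<Rightarrow> real) \<Rightarrow> (nat \<Rightarrow> real) \<Rightarrow> (nat \<Rightarrow> real)"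
  where "differential d f x v =
    (\<lambda>j. if j < d then (\<Sum>i<d. partial_deriv i (\<lambda>y. f y j) x * v i) else 0)"

subsection \<open>Symplectic diffeomorphisms and symplectic homeomorphisms\<close>

text \<open>
  The form \<open>dx\<^sub>1 \<and> dy\<^sub>1 + \<dots> + dx\<^sub>n \<and> dy\<^sub>n\<close> in the coordinates
  \<open>(x\<^sub>1, \<dots>, x\<^sub>n, y\<^sub>1, \<dots>, y\<^sub>n)\<close>, numbered from \<open>0\<close> to \<open>2 * n - 1\<close>.
\<close>
definition std_symplectic_form :: "nat \<Rightarrow> (nat \<Rightarrow> real) \<Rightarrow> (nat \<Rightarrow> real) \<Rightarrow> real"
  where "std_symplectic_form n u v = (\<Sum>i<n. u i * v (n + i) - u (n + i) * v i)"

abbreviation open_homeomorphism ::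
    "nat \<Rightarrow> (nat \<Rightarrow> real) set \<Rightarrow> (nat \<Rightarrow> real) set \<Rightarrow> ((nat \<Rightarrow> real) \<Rightarrow> (nat \<Rightarrow> real)) \<Rightarrow> bool"
  where "open_homeomorphism d U V f \<equiv>
    openin (Euclidean_space d) U \<and> openin (Euclidean_space d) V \<and>
    homeomorphic_map (subtopology (Euclidean_space d) U) (subtopology (Euclidean_space d) V) f"

definition symplectic_diffeo ::
    "nat \<Rightarrow> (nat \<Rightarrow> real) set \<Rightarrow> (nat \<Rightarrow> real) set \<Rightarrow> ((nat \<Rightarrow> real) \<Rightarrow> (nat \<Rightarrow> real)) \<Rightarrow> bool"
  where "symplectic_diffeo n U V f \<longleftrightarrow>
    open_homeomorphism (2 * n) U V f \<and>
    smooth_map_on (2 * n) f U \<and> smooth_map_on (2 * n) (inv_into U f) V \<and>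
    (\<forall>x\<in>U. \<forall>u\<in>topspace (Euclidean_space (2 * n)). \<forall>v\<in>topspace (Euclidean_space (2 * n)).
       std_symplectic_form n (differential (2 * n) f x u) (differential (2 * n) f x v) =
       std_symplectic_form n u v)"

text \<open>Uniform convergence on \<open>W\<close> in the Euclidean distance of \<open>\<real>\<^sup>d\<close>.\<close>
definition uniformly_converges_on ::
    "nat \<Rightarrow> (nat \<Rightarrow> real) set \<Rightarrow> (nat \<Rightarrow> (nat \<Rightarrow> real) \<Rightarrow> (nat \<Rightarrow> real)) \<Rightarrow>
     ((nat \<Rightarrow> real) \<Rightarrow> (nat \<Rightarrow> real)) \<Rightarrow> bool"
  where "uniformly_converges_on d W g f \<longleftrightarrow>
    (\<forall>e>0. \<forall>\<^sub>F k in sequentially. \<forall>x\<in>W. L2_set (\<lambda>i. g k x i - f x i) {..<d} < e)"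

definition symplectic_homeo ::
    "nat \<Rightarrow> (nat \<Rightarrow> real) set \<Rightarrow> (nat \<Rightarrow> real) set \<Rightarrow> ((nat \<Rightarrow> real) \<Rightarrow> (nat \<Rightarrow> real)) \<Rightarrow> bool"
  where "symplectic_homeo n U V f \<longleftrightarrow>
    open_homeomorphism (2 * n) U V f \<and>
    (\<forall>x\<in>U. \<exists>W g. openin (Euclidean_space (2 * n)) W \<and> x \<in> W \<and> W \<subseteq> U \<and>
       (\<forall>k. symplectic_diffeo n W (g k ` W) (g k)) \<and>
       uniformly_converges_on (2 * n) W g f)"

subsection \<open>Topological symplectic manifolds\<close>

text \<open>
  A chart is a pair \<open>(U, \<phi>)\<close>; the values of \<open>\<phi>\<close> outside \<open>U\<close> are irrelevant.
\<close>
type_synonym 'a chart = "'a set \<times> ('a \<Rightarrow> nat \<Rightarrow> real)"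

definition is_chart :: "nat \<Rightarrow> 'a topology \<Rightarrow> 'a chart \<Rightarrow> bool"
  where "is_chart d X c \<longleftrightarrow> (case c of (U, \<phi>) \<Rightarrow>
    openin X U \<and> openin (Euclidean_space d) (\<phi> ` U) \<and>
    homeomorphic_map (subtopology X U) (subtopology (Euclidean_space d) (\<phi> ` U)) \<phi>)"

definition symplectic_transition :: "nat \<Rightarrow> 'a chart \<Rightarrow> 'a chart \<Rightarrow> bool"
  where "symplectic_transition n c c' \<longleftrightarrow> (case c of (U, \<phi>) \<Rightarrow> case c' of (V, \<psi>) \<Rightarrow>
    symplectic_homeo n (\<phi> ` (U \<inter> V)) (\<psi> ` (U \<inter> V)) (\<psi> \<circ> inv_into U \<phi>))"

definition second_countable_space :: "'a topology \<Rightarrow> bool"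
  where "second_countable_space X \<longleftrightarrow>
    (\<exists>\<B>. countable \<B> \<and> (\<forall>B\<in>\<B>. openin X B) \<and>
         (\<forall>U x. openin X U \<and> x \<in> U \<longrightarrow> (\<exists>B\<in>\<B>. x \<in> B \<and> B \<subseteq> U)))"

definition topological_symplectic_manifold :: "nat \<Rightarrow> 'a topology \<Rightarrow> 'a chart set \<Rightarrow> bool"
  where "topological_symplectic_manifold n X \<A> \<longleftrightarrow>
    Hausdorff_space X \<and> second_countable_space X \<and>
    (\<forall>c\<in>\<A>. is_chart (2 * n) X c) \<and> (\<Union>c\<in>\<A>. fst c) = topspace X \<and>
    (\<forall>c\<in>\<A>. \<forall>c'\<in>\<A>. symplectic_transition n c c')"

definition topological_symplectic_chart ::
    "nat \<Rightarrow> 'a topology \<Rightarrow> 'a chart set \<Rightarrow> 'a chart \<Rightarrow> bool"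
  where "topological_symplectic_chart n X \<A> c \<longleftrightarrow>
    is_chart (2 * n) X c \<and>
    (\<forall>a\<in>\<A>. symplectic_transition n c a \<and> symplectic_transition n a c)"

definition push_chart :: "'a set \<Rightarrow> ('a \<Rightarrow> 'b) \<Rightarrow> 'a chart \<Rightarrow> 'b chart"
  where "push_chart S h c = (case c of (U, \<phi>) \<Rightarrow> (h ` U, \<phi> \<circ> inv_into S h))"

definition manifold_symplectic_homeo ::
    "nat \<Rightarrow> 'a topology \<Rightarrow> 'a chart set \<Rightarrow> 'b topology \<Rightarrow> 'b chart set \<Rightarrow> ('a \<Rightarrow> 'b) \<Rightarrow> bool"
  where "manifold_symplectic_homeo n X \<A> Y \<B> h \<longleftrightarrow>
    homeomorphic_map X Y h \<and>
    (\<forall>c. topological_symplectic_chart n X \<A> c \<longrightarrow>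
         topological_symplectic_chart n Y \<B> (push_chart (topspace X) h c))"

definition symplectically_homeomorphic ::
    "nat \<Rightarrow> 'a topology \<Rightarrow> 'a chart set \<Rightarrow> 'b topology \<Rightarrow> 'b chart set \<Rightarrow> bool"
  where "symplectically_homeomorphic n X \<A> Y \<B> \<longleftrightarrow>
    (\<exists>h. manifold_symplectic_homeo n X \<A> Y \<B> h)"

text \<open>
  A Hausdorff second countable manifold has at most continuum many points, so carriers inside
  \<^typ>\<open>nat \<Rightarrow> real\<close> realise every topological symplectic manifold up to symplectic
  homeomorphism.
\<close>
type_synonym point = "nat \<Rightarrow> real"

end

theory Submission
  imports Defs
begin

text \<open>
  The plane and the open unit disc are homeomorphic, but no symplectic homeomorphism maps the plane
  onto the disc because it cannot decrease area. A planar symplectic diffeomorphism has Jacobian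
  determinant \<open>1\<close>, so it preserves area. If such maps \<open>g\<^sub>k\<close> converge uniformly to \<open>f\<close> on a
  compact \<open>K\<close>, then every open neighbourhood of \<open>f K\<close> eventually contains \<open>g\<^sub>k K\<close>, so outer
  regularity gives \<open>\<lambda>(K) \<le> \<lambda>(f K)\<close>. By Vitali's theorem the domain is, up to a null set, a
  countable disjoint union of closed discs on which this applies, and summing gives the inequality
  for the whole domain.
\<close>

section \<open>Identifying \<open>real^2\<close> with the abstract Euclidean plane\<close>

text \<open>Derivatives, Lebesgue measure and the Vitali theorem are applied on
  \<open>real^2\<close>, whereas charts take values in sequences supported on the indices 0 and 1.
  This map and \<open>plane_proj\<close> carry statements from one model to the other; vector index
  1 becomes sequence index 0, and 2 becomes 1.\<close>

definition plane_embed :: "real^2 \<Rightarrow> nat \<Rightarrow> real"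
  where "plane_embed v = (\<lambda>i. if i = 0 then v $ 1 else if i = 1 then v $ 2 else 0)"

definition plane_proj :: "(nat \<Rightarrow> real) \<Rightarrow> real^2"
  where "plane_proj x = vector [x 0, x 1]"

lemma plane_embed_simps [simp]:
  "plane_embed v 0 = v $ 1" "plane_embed v (Suc 0) = v $ 2"
  by (simp_all add: plane_embed_def)

lemma plane_proj_nth [simp]: "plane_proj x $ 1 = x 0" "plane_proj x $ 2 = x 1"
  by (simp_all add: plane_proj_def)

lemma plane_proj_embed [simp]: "plane_proj (plane_embed v) = v"
  by (simp add: vec_eq_iff forall_2)

lemma plane_embed_in [simp]: "plane_embed v \<in> topspace (Euclidean_space 2)"
  by (simp add: topspace_Euclidean_space plane_embed_def)

lemma plane_embed_proj:
  "x \<in> topspace (Euclidean_space 2) \<Longrightarrow> plane_embed (plane_proj x) = x"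
  by (auto simp: topspace_Euclidean_space plane_embed_def fun_eq_iff less_2_cases_iff not_le
      dest!: leI)

lemma continuous_plane_embed: "continuous_map euclidean (Euclidean_space 2) plane_embed"
proof -
  have eq: "plane_embed =
      (\<lambda>v i. if i < 2 then (\<lambda>v i. if i = 0 then v $ 1 else v $ 2) v i else 0)"
    by (auto simp: plane_embed_def fun_eq_iff)
  show ?thesis
    unfolding eq continuous_map_componentwise_Euclidean_space
    by (auto intro!: continuous_intros)
qed

lemma continuous_plane_proj: "continuous_map (Euclidean_space 2) euclidean plane_proj"
  unfolding continuous_map_Euclidean_space_iff
proof (rule continuous_on_subset)
  have "continuous_on UNIV (\<lambda>x::nat \<Rightarrow> real. x i)" for i
    by (rule continuous_on_product_coordinates)
  then show "continuous_on UNIV plane_proj"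
    unfolding plane_proj_def
    by (subst continuous_on_componentwise) 
       (auto simp: Basis_vec_def inner_axis forall_2 UNIV_2 )
qed simp

lemma homeomorphic_maps_plane:
  "homeomorphic_maps euclidean (Euclidean_space 2) plane_embed plane_proj"
  by (simp add: homeomorphic_maps_def continuous_plane_embed continuous_plane_proj plane_embed_proj)

lemma open_vimage_plane_embed:
  "openin (Euclidean_space 2) W \<Longrightarrow> open (plane_embed -` W)"
  using openin_continuous_map_preimage[OF continuous_plane_embed, of W]
  by (simp add: vimage_def)

section \<open>Differentiability and preservation of area\<close>

text \<open>Transporting \<open>f\<close> to pairs of reals reduces this to
  \<open>has_derivative_partialsI\<close>, which combines a derivative in the first variable at the
  point with a continuous partial derivative in the second variable on a product
  neighbourhood.\<close>

lemma has_derivative_real2_partials: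
  fixes f :: "real^2 \<Rightarrow> real"
  assumes "open W" "v \<in> W"
    and a: "\<And>w. w \<in> W \<Longrightarrow> ((\<lambda>t. f (vector [t, w $ 2])) has_field_derivative a w) (at (w $ 1))"
    and b: "\<And>w. w \<in> W \<Longrightarrow> ((\<lambda>t. f (vector [w $ 1, t])) has_field_derivative b w) (at (w $ 2))"
    and cont: "continuous_on W b"
  shows "(f has_derivative (\<lambda>h. a v * h $ 1 + b v * h $ 2)) (at v)"
proof -
  define vec2 where "vec2 = (\<lambda>p::real \<times> real. vector [fst p, snd p] :: real^2)"
  have vec2_cont: "continuous_on UNIV vec2"
    unfolding vec2_def
    by (subst continuous_on_componentwise)
       (auto simp: Basis_vec_def inner_axis forall_2 UNIV_2 intro!: continuous_intros)
  have vec2_nth [simp]: "vec2 (w $ 1, w $ 2) = w" for w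
    by (simp add: vec2_def vec_eq_iff forall_2)
  have "open (vec2 -` W)"
    using \<open>open W\<close> vec2_cont by (simp add: open_vimage)
  moreover have "(v $ 1, v $ 2) \<in> vec2 -` W" using \<open>v \<in> W\<close> by simp
  ultimately obtain A B where AB: "open A" "open B" "v $ 1 \<in> A" "v $ 2 \<in> B" "A \<times> B \<subseteq> vec2 -` W"
    by (rule open_prod_elim) auto
  obtain e where e: "e > 0" "ball (v $ 2) e \<subseteq> B"
    using AB by (meson open_contains_ball)
  \<comment> \<open>The second factor has to be convex, so \<open>B\<close> is shrunk to a
    ball.\<close>
  define Y where "Y = ball (v $ 2) e"
  have sub: "A \<times> Y \<subseteq> vec2 -` W" using AB e by (auto simp: Y_def)
  have Y: "open Y" "convex Y" "v $ 2 \<in> Y" using e by (auto simp: Y_def)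
  \<comment> \<open>The second partial derivative must be a bounded linear map;
    \<open>blinfun_scaleR_left c\<close> is multiplication by the number \<open>c\<close>.\<close>
  have "((\<lambda>(x, y). f (vec2 (x, y))) has_derivative
      (\<lambda>(tx, ty). a v * tx + blinfun_scaleR_left (b (vec2 (v $ 1, v $ 2))) ty)) (at (v $ 1, v $ 2) within A \<times> Y)"
  proof (rule has_derivative_partialsI[where fy = "\<lambda>x y. blinfun_scaleR_left (b (vec2 (x, y)))"])
    show "((\<lambda>x. f (vec2 (x, v $ 2))) has_derivative (\<lambda>tx. a v * tx)) (at (v $ 1) within A)"
      using a[OF \<open>v \<in> W\<close>]
      by (auto simp: has_field_derivative_def vec2_def intro: has_derivative_at_withinI)
    fix x y assume "x \<in> A" "y \<in> Y"
    then have "vec2 (x, y) \<in> W" using sub by blast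
    from b[OF this]
    have "((\<lambda>y. f (vec2 (x, y))) has_derivative (\<lambda>t. b (vec2 (x, y)) * t)) (at y)"
      by (simp add: has_field_derivative_def vec2_def)
    then show "((\<lambda>y. f (vec2 (x, y))) has_derivative blinfun_scaleR_left (b (vec2 (x, y)))) (at y within Y)"
      by (auto intro!: has_derivative_at_withinI simp: mult.commute)
  next
    have "continuous_on (A \<times> Y) (\<lambda>p. b (vec2 p))"
      by (rule continuous_on_compose2[OF cont continuous_on_subset[OF vec2_cont]])
         (use sub in auto)
    then have "continuous_on (A \<times> Y) (\<lambda>(x, y). blinfun_scaleR_left (b (vec2 (x, y))))"
      unfolding case_prod_unfold by (auto intro!: continuous_intros)
    then show "continuous (at (v $ 1, v $ 2) within A \<times> Y)
        (\<lambda>(x, y). blinfun_scaleR_left (b (vec2 (x, y))))"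
      using AB Y unfolding continuous_on_eq_continuous_within by blast
  qed (use Y in auto)
  then have "((\<lambda>(x, y). f (vec2 (x, y))) has_derivative (\<lambda>(tx, ty). a v * tx + b v * ty))
      (at (v $ 1, v $ 2))"
    using AB Y by (subst (asm) at_within_open) (auto simp: open_Times mult.commute)
  moreover have "((\<lambda>w::real^2. (w $ 1, w $ 2)) has_derivative (\<lambda>h. (h $ 1, h $ 2))) (at v)"
    by (intro has_derivative_Pair bounded_linear_imp_has_derivative bounded_linear_vec_nth)
  ultimately show ?thesis
    using has_derivative_compose[of "\<lambda>w::real^2. (w $ 1, w $ 2)" "\<lambda>h. (h $ 1, h $ 2)" v UNIV
        "\<lambda>(x, y). f (vec2 (x, y))" "\<lambda>(tx, ty). a v * tx + b v * ty"]
    by simp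
qed

text \<open>\<open>Ck_on\<close> speaks only of derivatives along coordinate lines and of
  continuity. One order of it already supplies continuous partial derivatives, hence a total
  derivative in the vector model.\<close>

lemma Ck_on_imp_has_derivative:
  assumes W: "openin (Euclidean_space 2) W" and f: "Ck_on 2 (Suc 0) f W"
    and v: "plane_embed v \<in> W"
  shows "((\<lambda>w. f (plane_embed w)) has_derivative
      (\<lambda>h. partial_deriv 0 f (plane_embed v) * h $ 1 + partial_deriv 1 f (plane_embed v) * h $ 2)) (at v)"
proof (rule has_derivative_real2_partials)
  let ?O = "plane_embed -` W"
  show "open ?O" by (rule open_vimage_plane_embed[OF W])
  show "v \<in> ?O" using v by simp
  \<comment> \<open>Changing coordinate 0 or 1 of an embedded point gives an embedded point again,
    so the coordinate lines of the two models match.\<close>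
  have upd: "(plane_embed w)(0 := t) = plane_embed (vector [t, w $ 2])"
    "(plane_embed w)(Suc 0 := t) = plane_embed (vector [w $ 1, t])" for w t
    by (auto simp: plane_embed_def fun_eq_iff)
  fix w assume "w \<in> ?O"
  then have w: "plane_embed w \<in> W" by simp
  have "(\<lambda>t. f ((plane_embed w)(i := t))) field_differentiable at (plane_embed w i)" if "i < 2" for i
    using f w that by (auto simp: numeral_2_eq_2)
  then have d: "((\<lambda>t. f ((plane_embed w)(i := t))) has_field_derivative
      partial_deriv i f (plane_embed w)) (at (plane_embed w i))" if "i < 2" for i
    using that unfolding partial_deriv_def by (simp add: DERIV_deriv_iff_field_differentiable)
  show "((\<lambda>t. f (plane_embed (vector [t, w $ 2]))) has_field_derivative
      partial_deriv 0 f (plane_embed w)) (at (w $ 1))"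
    using d[of 0] by (simp add: upd)
  show "((\<lambda>t. f (plane_embed (vector [w $ 1, t]))) has_field_derivative
      partial_deriv 1 f (plane_embed w)) (at (w $ 2))"
    using d[of 1] by (simp add: upd)
next
  have "continuous_map (subtopology (Euclidean_space 2) W) euclideanreal (partial_deriv 1 f)"
    using f by (simp add: numeral_2_eq_2)
  moreover have "continuous_map (top_of_set (plane_embed -` W)) (subtopology (Euclidean_space 2) W) plane_embed"
    by (auto simp: continuous_map_in_subtopology intro: continuous_map_from_subtopology continuous_plane_embed)
  ultimately show "continuous_on (plane_embed -` W) (\<lambda>w. partial_deriv 1 f (plane_embed w))"
    by (auto dest: continuous_map_compose simp: o_def)
qed

text \<open>In dimension two the symplectic form of two vectors is their determinant. Preserving it
  makes the Jacobian determinant 1, and the change of variables formula then preserves area.\<close>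

lemma symplectic_diffeo_measure_image:
  assumes g: "symplectic_diffeo 1 W V g" and K: "compact K" "K \<subseteq> plane_embed -` W"
  shows "emeasure lebesgue ((plane_proj \<circ> g \<circ> plane_embed) ` K) = emeasure lebesgue K"
proof -
  let ?G = "plane_proj \<circ> g \<circ> plane_embed"
  define J where "J = (\<lambda>i j v. partial_deriv i (\<lambda>x. g x j) (plane_embed v))"
  define G' where "G' = (\<lambda>v (h :: real^2). vector [J 0 0 v * h $ 1 + J 1 0 v * h $ 2,
      J 0 1 v * h $ 1 + J 1 1 v * h $ 2] :: real^2)"
  have W: "openin (Euclidean_space 2) W"
    and hom: "homeomorphic_map (subtopology (Euclidean_space 2) W) (subtopology (Euclidean_space 2) V) g"
    and smooth: "smooth_map_on 2 g W"
    and form: "\<And>x u v. x \<in> W \<Longrightarrow> u \<in> topspace (Euclidean_space 2) \<Longrightarrow> v \<in> topspace (Euclidean_space 2) \<Longrightarrow>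
       std_symplectic_form 1 (differential 2 g x u) (differential 2 g x v) = std_symplectic_form 1 u v"
    using g unfolding symplectic_diffeo_def by auto
  have Ck: "Ck_on 2 (Suc 0) (\<lambda>x. g x j) W" if "j < 2" for j
    using smooth that unfolding smooth_map_on_def by blast
  have W2: "W \<subseteq> topspace (Euclidean_space 2)"
    using W by (rule openin_subset)
  have der: "(?G has_derivative G' v) (at v within K)" if "v \<in> K" for v
  proof (rule has_derivative_at_withinI)
    have v: "plane_embed v \<in> W" using that K by blast
    have "((\<lambda>w. ?G w $ i) has_derivative (\<lambda>h. G' v h $ i)) (at v)" for i
      using exhaust_2[of i] Ck_on_imp_has_derivative[OF W Ck v, of 0]
        Ck_on_imp_has_derivative[OF W Ck v, of 1]
      by (auto simp: G'_def J_def)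
    then show "(?G has_derivative G' v) (at v)"
      unfolding has_derivative_componentwise_within[of ?G]
      by (auto simp: Basis_vec_def inner_axis)
  qed
  have det: "det (matrix (G' v)) = 1" if "v \<in> K" for v
  proof -
    have v: "plane_embed v \<in> W" using that K by blast
    show ?thesis
      \<comment> \<open>On the two standard basis vectors the form equals 1, and on their images
        under the differential it is the Jacobian determinant.\<close>
      using form[OF v plane_embed_in plane_embed_in, of "axis 1 1" "axis 2 1"]
      by (simp add: mult.commute std_symplectic_form_def differential_def det_2 matrix_def G'_def J_def
          numeral_2_eq_2 axis_def)
  qed
  have "inj_on g W"
    using homeomorphic_imp_injective_map[OF hom] W2 by (simp add: Int_absorb1)
  moreover have "g ` W \<subseteq> topspace (Euclidean_space 2)"
    using homeomorphic_imp_surjective_map[OF hom] W2 by auto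
  ultimately have inj: "inj_on ?G K"
    using K(2) by (intro inj_onI) (metis comp_apply image_subset_iff inj_onD plane_embed_proj
        plane_proj_embed subsetD vimage_eq)
  have K_meas: "K \<in> lmeasurable" by (rule lmeasurable_compact[OF K(1)])
  have const: "(\<lambda>v. \<bar>det (matrix (G' v))\<bar>) integrable_on K"
    using integrable_on_const[OF K_meas, of "1::real"]
    by (subst integrable_cong[of _ _ "\<lambda>_. 1"]) (simp_all add: det)
  have "measure lebesgue (?G ` K) = integral K (\<lambda>v. \<bar>det (matrix (G' v))\<bar>)"
    using K_meas by (intro measure_differentiable_image_eq der inj const) auto
  also have "\<dots> = measure lebesgue K"
    unfolding lmeasure_integral[OF K_meas] by (intro integral_cong) (simp add: det)
  finally have "measure lebesgue (?G ` K) = measure lebesgue K" .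
  moreover have "?G ` K \<in> lmeasurable"
    using measurable_differentiable_image_eq[OF _ der inj] const K_meas by auto
  ultimately show ?thesis
    using K_meas by (simp add: emeasure_eq_measure2)
qed

section \<open>Area under local uniform limits\<close>

text \<open>This is upper semicontinuity of the volume of a compact image: an open \<open>T\<close>
  around the limit image with little excess volume contains a whole \<open>d\<close>-neighbourhood
  of it, hence also the image under any \<open>G k\<close> uniformly closer than
  \<open>d\<close>.\<close>

lemma emeasure_le_uniform_limit_image:
  fixes F :: "'a::euclidean_space \<Rightarrow> 'a"
  assumes K: "compact K" and F: "continuous_on K F"
    and meas: "\<And>k. G k ` K \<in> sets lebesgue" "\<And>k. emeasure lebesgue (G k ` K) = m"
    and lim: "uniform_limit K G F sequentially"
  shows "m \<le> emeasure lebesgue (F ` K)"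
proof (rule ennreal_le_epsilon)
  fix e :: real assume "e > 0"
  have cpt: "compact (F ` K)" using K F by (rule compact_continuous_image[rotated])
  then have FK: "F ` K \<in> sets lebesgue" by (simp add: lmeasurable_compact fmeasurableD)
  obtain T where T: "open T" "F ` K \<subseteq> T" "T - F ` K \<in> lmeasurable"
      "emeasure lebesgue (T - F ` K) < ennreal e"
    using sets_lebesgue_outer_open[OF FK \<open>e > 0\<close>] by metis
  obtain d where d: "d > 0" "(\<Union>x\<in>F ` K. ball x d) \<subseteq> T"
    using compact_subset_open_imp_ball_epsilon_subset[OF cpt T(1,2)] by metis
  obtain k where k: "\<forall>x\<in>K. dist (G k x) (F x) < d"
    using uniform_limitD[OF lim d(1)] by (auto simp: eventually_sequentially)
  have "G k ` K \<subseteq> T"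
  proof
    fix y assume "y \<in> G k ` K"
    then obtain x where "x \<in> K" "y = G k x" by blast
    then have "y \<in> ball (F x) d" using k by (simp add: dist_commute)
    with \<open>x \<in> K\<close> d(2) show "y \<in> T" by blast
  qed
  then have "m \<le> emeasure lebesgue T"
    using emeasure_mono[of "G k ` K" T lebesgue] meas T(1) by auto
  also have "\<dots> = emeasure lebesgue (F ` K \<union> (T - F ` K))"
    using T(2) by (simp add: Un_absorb1)
  also have "\<dots> \<le> emeasure lebesgue (F ` K) + emeasure lebesgue (T - F ` K)"
    using FK T(3) by (intro emeasure_subadditive) auto
  also have "\<dots> \<le> emeasure lebesgue (F ` K) + ennreal e"
    using T(4) by (intro add_left_mono) simp
  finally show "m \<le> emeasure lebesgue (F ` K) + ennreal e" .
qed


lemma homeomorphic_map_plane: "homeomorphic_map euclidean (Euclidean_space 2) plane_embed"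
  using homeomorphic_maps_plane homeomorphic_map_maps by blast

text \<open>Approximating sequences exist only near each point, so the area inequality is first
  obtained on small discs. Vitali selects disjoint discs that exhaust the domain up to a null set,
  and injectivity keeps their images disjoint inside the target, so the inequalities add up.\<close>

lemma symplectic_homeo_emeasure_le:
  assumes f: "symplectic_homeo 1 U V f"
  shows "emeasure lebesgue (plane_embed -` U) \<le> emeasure lebesgue (plane_embed -` V)"
proof -
  define O' where "O' = plane_embed -` U"
  define F where "F = plane_proj \<circ> f \<circ> plane_embed"
  have U: "openin (Euclidean_space 2) U" and V: "openin (Euclidean_space 2) V"
    and hom: "homeomorphic_map (subtopology (Euclidean_space 2) U) (subtopology (Euclidean_space 2) V) f"
    using f unfolding symplectic_homeo_def by auto
  have loc: "\<exists>W g. openin (Euclidean_space 2) W \<and> x \<in> W \<and> W \<subseteq> U \<and>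
       (\<forall>k. symplectic_diffeo 1 W (g k ` W) (g k)) \<and> uniformly_converges_on 2 W g f" if "x \<in> U" for x
    using f that unfolding symplectic_homeo_def by simp
  have U_sub: "U \<subseteq> topspace (Euclidean_space 2)" and V_sub: "V \<subseteq> topspace (Euclidean_space 2)"
    using U V openin_subset by blast+
  have "open O'" unfolding O'_def by (rule open_vimage_plane_embed[OF U])
  have f_img: "f ` U = V"
    using homeomorphic_imp_surjective_map[OF hom] U_sub V_sub by (simp add: Int_absorb1)
  have f_inj: "inj_on f U"
    using homeomorphic_imp_injective_map[OF hom] U_sub by (simp add: Int_absorb1)
  \<comment> \<open>The values of \<open>f\<close> on \<open>U\<close> lie in \<open>V\<close>,
    hence in the embedded plane, where projecting and embedding again changes nothing.\<close>
  have F_embed: "plane_embed (F w) = f (plane_embed w)" if "w \<in> O'" for w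
    using that f_img V_sub by (auto simp: F_def O'_def intro!: plane_embed_proj)
  have F_img: "F ` O' \<subseteq> plane_embed -` V"
    using F_embed f_img by (auto simp: O'_def)
  have F_inj: "inj_on F O'"
  proof (rule inj_onI)
    fix w w' assume w: "w \<in> O'" "w' \<in> O'" and "F w = F w'"
    then have "f (plane_embed w) = f (plane_embed w')" by (metis F_embed)
    then have "plane_embed w = plane_embed w'"
      using f_inj w by (auto simp: O'_def inj_on_def)
    then show "w = w'" by (metis plane_proj_embed)
  qed
  have F_cont: "continuous_on O' F"
  proof -
    have embed: "continuous_map (top_of_set O') (subtopology (Euclidean_space 2) U) plane_embed"
      by (auto simp: O'_def continuous_map_in_subtopology
          intro: continuous_map_from_subtopology continuous_plane_embed)
    have "continuous_map (subtopology (Euclidean_space 2) U) (Euclidean_space 2) f"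
      using homeomorphic_imp_continuous_map[OF hom] by (simp add: continuous_map_in_subtopology)
    from continuous_map_compose[OF continuous_map_compose[OF embed this] continuous_plane_proj]
    show ?thesis by (simp add: F_def o_assoc)
  qed
  \<comment> \<open>Discs are indexed by centre and radius. The area inequality is part of
    membership, so every disc that Vitali selects inherits it.\<close>
  define I where "I = {(x, r). 0 < r \<and> cball x r \<subseteq> O' \<and>
      emeasure lebesgue (cball x r) \<le> emeasure lebesgue (F ` cball x r)}"
  have small: "\<exists>i. i \<in> I \<and> x \<in> cball (fst i) (snd i) \<and> snd i < d" if x: "x \<in> O'" and "0 < d" for x d
  proof -
    obtain W g where W: "openin (Euclidean_space 2) W" "plane_embed x \<in> W" "W \<subseteq> U"
      and g: "\<And>k. symplectic_diffeo 1 W (g k ` W) (g k)" and lim: "uniformly_converges_on 2 W g f"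
      using loc[of "plane_embed x"] x unfolding O'_def by auto
    obtain e where e: "e > 0" "cball x e \<subseteq> plane_embed -` W"
      using open_vimage_plane_embed[OF W(1)] W(2) by (meson open_contains_cball vimageI)
    \<comment> \<open>The bound \<open>e\<close> keeps the disc where the sequence converges;
      \<open>d / 2\<close> makes the radius strictly smaller than \<open>d\<close>, as a fine cover
      requires.\<close>
    define r where "r = min e (d / 2)"
    define G where "G k = plane_proj \<circ> g k \<circ> plane_embed" for k
    have r: "0 < r" "r < d" "cball x r \<subseteq> plane_embed -` W"
      using e \<open>0 < d\<close> by (auto simp: r_def)
    have sub: "cball x r \<subseteq> O'" using r W(3) by (auto simp: O'_def)
    have meas: "emeasure lebesgue (G k ` cball x r) = emeasure lebesgue (cball x r)" for k
      unfolding G_def by (rule symplectic_diffeo_measure_image[OF g]) (use r in auto)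
    have "uniform_limit (cball x r) G F sequentially"
    proof (rule uniform_limitI)
      fix \<epsilon> :: real assume "\<epsilon> > 0"
      then have "\<forall>\<^sub>F k in sequentially. \<forall>x\<in>W. L2_set (\<lambda>i. g k x i - f x i) {..<2} < \<epsilon>"
        using lim by (simp add: uniformly_converges_on_def)
      then show "\<forall>\<^sub>F k in sequentially. \<forall>w\<in>cball x r. dist (G k w) (F w) < \<epsilon>"
      proof (rule eventually_mono, safe)
        fix k w assume *: "\<forall>x\<in>W. L2_set (\<lambda>i. g k x i - f x i) {..<2} < \<epsilon>" and "w \<in> cball x r"
        then have "plane_embed w \<in> W" using r by blast
        moreover have "dist (G k w) (F w) =
            L2_set (\<lambda>i. g k (plane_embed w) i - f (plane_embed w) i) {..<2}"
          by (simp add: dist_vec_def L2_set_def G_def F_def UNIV_2 numeral_2_eq_2 dist_real_def)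
        ultimately show "dist (G k w) (F w) < \<epsilon>" using * by simp
      qed
    qed
    moreover have "G k ` cball x r \<in> sets lebesgue" for k
    \<comment> \<open>By convention a non-measurable set has \<open>emeasure\<close> 0, which
      contradicts equality with the positive area of the disc.\<close>
    proof (rule ccontr)
      assume "G k ` cball x r \<notin> sets lebesgue"
      then have "emeasure lebesgue (cball x r) = 0" using meas[of k] by (simp add: emeasure_notin_sets)
      then show False using r(1) using content_cball_pos[OF r(1), of x] by (simp add: measure_def)
    qed
    ultimately have "emeasure lebesgue (cball x r) \<le> emeasure lebesgue (F ` cball x r)"
      using meas by (intro emeasure_le_uniform_limit_image continuous_on_subset[OF F_cont sub]) auto
    then have "(x, r) \<in> I" using r sub by (simp add: I_def)
    then show ?thesis using r by (intro exI[of _ "(x, r)"]) auto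
  qed
  have pos: "0 < snd i" if "i \<in> I" for i
    using that by (auto simp: I_def)
  obtain C where C: "countable C" "C \<subseteq> I"
    and disj: "pairwise (\<lambda>i j. disjnt (cball (fst i) (snd i)) (cball (fst j) (snd j))) C"
    and neg: "negligible (O' - (\<Union>i\<in>C. cball (fst i) (snd i)))"
    by (rule Vitali_covering_theorem_cballs[of I snd O' fst, OF pos small])
  let ?B = "\<lambda>i. cball (fst i) (snd i)"
  have B: "?B i \<subseteq> O'" "emeasure lebesgue (?B i) \<le> emeasure lebesgue (F ` ?B i)" if "i \<in> C" for i
    using subsetD[OF C(2) that] by (simp_all add: I_def case_prod_unfold)
  have B_sets: "?B i \<in> sets lebesgue" for i by simp
  have FB_sets: "F ` ?B i \<in> sets lebesgue" if "i \<in> C" for i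
    using compact_continuous_image[OF continuous_on_subset[OF F_cont B(1)[OF that]] compact_cball]
    by (simp add: lmeasurable_compact fmeasurableD)
  have B_disj: "disjoint_family_on ?B C"
    using disj by (auto simp: disjoint_family_on_def pairwise_def disjnt_def)
  have FB_disj: "disjoint_family_on (\<lambda>i. F ` ?B i) C"
    unfolding disjoint_family_on_def
  proof (intro ballI impI)
    fix i j assume ij: "i \<in> C" "j \<in> C" "i \<noteq> j"
    then have "F ` ?B i \<inter> F ` ?B j = F ` (?B i \<inter> ?B j)"
      using inj_on_image_Int[OF F_inj B(1) B(1)] by blast
    also have "?B i \<inter> ?B j = {}" using B_disj ij by (auto simp: disjoint_family_on_def)
    finally show "F ` ?B i \<inter> F ` ?B j = {}" by simp
  qed
  have UB: "(\<Union>i\<in>C. ?B i) \<in> sets lebesgue" using C(1) B_sets by (intro sets.countable_UN') auto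
  have null: "O' - (\<Union>i\<in>C. ?B i) \<in> null_sets lebesgue"
    using neg negligible_iff_null_sets by blast
  \<comment> \<open>The null remainder is discarded on the domain side; on the target side the disc
    images only have to lie in the preimage of \<open>V\<close>.\<close>
  have "emeasure lebesgue O' \<le> emeasure lebesgue ((\<Union>i\<in>C. ?B i) \<union> (O' - (\<Union>i\<in>C. ?B i)))"
    using UB null_setsD2[OF null] by (intro emeasure_mono sets.Un) blast+
  also have "\<dots> = emeasure lebesgue (\<Union>i\<in>C. ?B i)"
    by (rule emeasure_Un_null_set[OF UB null])
  also have "\<dots> = (\<integral>\<^sup>+i. emeasure lebesgue (?B i) \<partial>count_space C)"
    by (rule emeasure_UN_countable[OF B_sets C(1) B_disj])
  also have "\<dots> \<le> (\<integral>\<^sup>+i. emeasure lebesgue (F ` ?B i) \<partial>count_space C)"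
    by (rule nn_integral_mono) (rule B(2), simp)
  also have "\<dots> = emeasure lebesgue (\<Union>i\<in>C. F ` ?B i)"
    by (rule emeasure_UN_countable[OF FB_sets C(1) FB_disj, symmetric])
  also have "\<dots> \<le> emeasure lebesgue (plane_embed -` V)"
  proof (rule emeasure_mono)
    show "(\<Union>i\<in>C. F ` ?B i) \<subseteq> plane_embed -` V" using B(1) F_img by blast
    show "plane_embed -` V \<in> sets lebesgue"
      using open_vimage_plane_embed[OF V] by (simp add: borel_open)
  qed
  finally show ?thesis unfolding O'_def .
qed

section \<open>The identity as a symplectic homeomorphism\<close>

lemma continuous_map_fun_upd_Euclidean_space:
  assumes "x \<in> topspace (Euclidean_space d)" "i < d"
  shows "continuous_map euclideanreal (Euclidean_space d) (\<lambda>t. x(i := t))"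
  unfolding Euclidean_space_def continuous_map_in_subtopology continuous_map_componentwise_UNIV
  using assms by (auto simp: topspace_Euclidean_space fun_upd_def)

text \<open>Openness of \<open>U\<close> keeps a short piece of each coordinate line through a point
  of \<open>U\<close> inside \<open>U\<close>, so derivatives there ignore values elsewhere. This
  handles \<open>inv_into\<close>, whose values off the image are arbitrary.\<close>

lemma Ck_on_cong:
  assumes U: "openin (Euclidean_space d) U"
  shows "(\<And>x. x \<in> U \<Longrightarrow> f x = g x) \<Longrightarrow> Ck_on d k f U \<Longrightarrow> Ck_on d k g U"
proof (induction k arbitrary: f g)
  case 0
  then show ?case by (auto elim: continuous_map_eq)
next
  case (Suc k)
  have near: "\<forall>\<^sub>F t in nhds (x i). f (x(i := t)) = g (x(i := t))" if "x \<in> U" "i < d" for x i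
  proof -
    have "x \<in> topspace (Euclidean_space d)" using that openin_subset[OF U] by blast
    from openin_continuous_map_preimage[OF continuous_map_fun_upd_Euclidean_space[OF this that(2)] U]
    have "open {t. x(i := t) \<in> U}" by simp
    moreover have "x i \<in> {t. x(i := t) \<in> U}" using that by simp
    ultimately show ?thesis
      unfolding eventually_nhds using Suc.prems(1) by blast
  qed
  have deriv_eq: "((\<lambda>t. f (x(i := t))) has_field_derivative D) (at (x i)) \<longleftrightarrow>
      ((\<lambda>t. g (x(i := t))) has_field_derivative D) (at (x i))" if "x \<in> U" "i < d" for x i D
    using near[OF that] by (intro DERIV_cong_ev) auto
  \<comment> \<open>The partial derivatives of \<open>f\<close> and \<open>g\<close> are compared
    only on \<open>U\<close>, which is why the induction generalises over both functions.\<close>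
  have "Ck_on d k (partial_deriv i g) U" if "i < d" for i
  proof (rule Suc.IH)
    show "partial_deriv i f x = partial_deriv i g x" if "x \<in> U" for x
      using deriv_eq[OF that \<open>i < d\<close>] by (simp add: partial_deriv_def deriv_def)
    show "Ck_on d k (partial_deriv i f) U"
      using Suc.prems(2) that by simp
  qed
  moreover have "continuous_map (subtopology (Euclidean_space d) U) euclideanreal g"
    using Suc.prems by (auto elim: continuous_map_eq)
  ultimately show ?case
    using Suc.prems(2) deriv_eq by (simp add: field_differentiable_def)
qed

lemma Ck_on_const: "Ck_on d k (\<lambda>x. c) U"
proof (induction k arbitrary: c)
  case (Suc k)
  have "partial_deriv i (\<lambda>x. c) = (\<lambda>x. 0)" for i
    by (simp add: partial_deriv_def fun_eq_iff)
  with Suc show ?case by simp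
qed simp

lemma partial_deriv_coordinate: "partial_deriv i (\<lambda>x. x j) = (\<lambda>x. if i = j then 1 else 0)"
  by (auto simp: partial_deriv_def fun_eq_iff)

text \<open>The partial derivatives are the constants 0 and 1, so a case split on \<open>k\<close>
  replaces induction.\<close>

lemma Ck_on_coordinate: "Ck_on d k (\<lambda>x. x j) U"
proof -
  have cont: "continuous_map (subtopology (Euclidean_space d) U) euclideanreal (\<lambda>x. x j)"
    unfolding Euclidean_space_def
    by (intro continuous_map_from_subtopology continuous_map_product_projection) simp
  show ?thesis
  proof (cases k)
    case (Suc m)
    have "(\<lambda>t. (x(i := t)) j) field_differentiable at (x i)" for x :: "nat \<Rightarrow> real" and i
      by (cases "i = j") auto
    then show ?thesis
      using cont Suc by (simp add: partial_deriv_coordinate Ck_on_const)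
  qed (use cont in simp)
qed

lemma symplectic_diffeo_id:
  assumes U: "openin (Euclidean_space (2 * n)) U"
  shows "symplectic_diffeo n U U (\<lambda>x. x)"
proof -
  have "inv_into U (\<lambda>x. x) x = x" if "x \<in> U" for x
    using inv_into_f_f[of "\<lambda>x. x" U x] that by simp
  then have "smooth_map_on (2 * n) (inv_into U (\<lambda>x. x)) U"
    unfolding smooth_map_on_def
    by (auto intro!: Ck_on_cong[OF U _ Ck_on_coordinate])
  \<comment> \<open>\<open>differential\<close> is 0 at indices from \<open>2 * n\<close> on, and so
    is \<open>u\<close>, being a point of the Euclidean space.\<close>
  moreover have "differential (2 * n) (\<lambda>x. x) x u = u"
    if "u \<in> topspace (Euclidean_space (2 * n))" for x u
    using that
    by (auto simp: differential_def partial_deriv_coordinate topspace_Euclidean_space fun_eq_iff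
        if_distrib[of "\<lambda>c. c * _"] cong: if_cong)
  ultimately show ?thesis
    using U homeomorphic_map_id
    by (auto simp: symplectic_diffeo_def smooth_map_on_def Ck_on_coordinate simp flip: id_def)
qed

text \<open>Constant sequences of identities on \<open>W = U\<close> serve as approximations.
  Agreement with the identity is asked only on \<open>U\<close> because transition maps contain
  \<open>inv_into\<close>.\<close>

lemma symplectic_homeo_identity:
  assumes U: "openin (Euclidean_space (2 * n)) U" and f: "\<And>x. x \<in> U \<Longrightarrow> f x = x"
  shows "symplectic_homeo n U U f"
proof -
  have "homeomorphic_map (subtopology (Euclidean_space (2 * n)) U) (subtopology (Euclidean_space (2 * n)) U) f"
    by (rule homeomorphic_map_eq[where f = id]) (use f in \<open>auto simp: homeomorphic_map_id\<close>)
  moreover have "uniformly_converges_on (2 * n) U (\<lambda>_ x. x) f"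
    using f by (simp add: uniformly_converges_on_def L2_set_def)
  ultimately show ?thesis
    unfolding symplectic_homeo_def
    using U symplectic_diffeo_id[OF U] by (auto intro!: exI[of _ U] exI[of _ "\<lambda>_ x. x"])
qed

lemma symplectic_transition_identity:
  assumes U: "openin (Euclidean_space (2 * n)) U"
  shows "symplectic_transition n (U, id) (U, id)"
proof -
  have "inv_into U id x = x" if "x \<in> U" for x
    using inv_into_f_f[of id U x] that by simp
  then show ?thesis
    using symplectic_homeo_identity[OF U] by (simp add: symplectic_transition_def)
qed

section \<open>Open sets as topological symplectic manifolds\<close>

lemma second_countable_space_subtopology_Euclidean:
  "second_countable_space (subtopology (Euclidean_space d) U)"
proof -
  obtain \<B> :: "(nat \<Rightarrow> real) set set" where "countable \<B>" "topological_basis \<B>"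
    using ex_countable_basis by blast
  then have "second_countable (euclidean :: (nat \<Rightarrow> real) topology)"
    unfolding second_countable_def
    by (metis open_openin topological_basisE topological_basis_open)
  then have "second_countable (subtopology (Euclidean_space d) U)"
    unfolding Euclidean_space_def euclidean_product_topology
    by (intro second_countable_subtopology)
  then show ?thesis
    by (simp add: second_countable_def second_countable_space_def)
qed

lemma is_chart_identity:
  assumes U: "openin (Euclidean_space d) U"
  shows "is_chart d (subtopology (Euclidean_space d) U) (U, id)"
  using U homeomorphic_map_id
  by (simp add: is_chart_def subtopology_subtopology openin_subtopology_refl openin_subset)

text \<open>With a single global chart the only transition map is the identity on
  \<open>U\<close>.\<close>

lemma topological_symplectic_manifold_open:
  assumes U: "openin (Euclidean_space (2 * n)) U"
  shows "topological_symplectic_manifold n (subtopology (Euclidean_space (2 * n)) U) {(U, id)}"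
proof -
  have "Hausdorff_space (Euclidean_space d)" for d
    unfolding Euclidean_space_def euclidean_product_topology
    by (simp add: Hausdorff_space_subtopology)
  then show ?thesis
    using U openin_subset[OF U]
    by (auto simp: topological_symplectic_manifold_def Hausdorff_space_subtopology
        second_countable_space_subtopology_Euclidean is_chart_identity symplectic_transition_identity)
qed

text \<open>A manifold homeomorphism must carry the global chart of \<open>U\<close> to a chart
  compatible with the global chart of \<open>V\<close>; the transition map between these two charts
  is the required \<open>f\<close>.\<close>

lemma symplectically_homeomorphic_open_imp_symplectic_homeo:
  assumes U: "openin (Euclidean_space (2 * n)) U" and V: "openin (Euclidean_space (2 * n)) V"
    and "symplectically_homeomorphic n
      (subtopology (Euclidean_space (2 * n)) U) {(U, id)}
      (subtopology (Euclidean_space (2 * n)) V) {(V, id)}"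
  obtains f where "symplectic_homeo n U V f"
proof -
  let ?X = "subtopology (Euclidean_space (2 * n)) U"
  let ?Y = "subtopology (Euclidean_space (2 * n)) V"
  obtain h where h: "manifold_symplectic_homeo n ?X {(U, id)} ?Y {(V, id)} h"
    using assms(3) by (auto simp: symplectically_homeomorphic_def)
  have top: "topspace ?X = U" "topspace ?Y = V"
    using openin_subset[OF U] openin_subset[OF V] by auto
  have hom: "homeomorphic_map ?X ?Y h"
    using h by (simp add: manifold_symplectic_homeo_def)
  have hU: "h ` U = V" and inj: "inj_on h U"
    using homeomorphic_imp_surjective_map[OF hom] homeomorphic_imp_injective_map[OF hom]
    by (simp_all only: top)
  have "topological_symplectic_chart n ?X {(U, id)} (U, id)"
    using U by (simp add: topological_symplectic_chart_def is_chart_identity symplectic_transition_identity)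
  then have "topological_symplectic_chart n ?Y {(V, id)} (push_chart U h (U, id))"
    using h unfolding manifold_symplectic_homeo_def top by blast
  \<comment> \<open>The pushed chart is the inverse of \<open>h\<close>, so the transition from it
    to \<open>id\<close> inverts it once more and runs from \<open>U\<close> to
    \<open>V\<close>.\<close>
  then have "symplectic_transition n (V, id \<circ> inv_into U h) (V, id)"
    by (simp add: topological_symplectic_chart_def push_chart_def hU)
  moreover have "inv_into U h ` V = U"
    using inj hU by (metis inv_into_image_cancel order_refl)
  ultimately show thesis
    using that by (simp add: symplectic_transition_def)
qed

section \<open>The plane and the unit disc\<close>

theorem corollary1p3:
  shows "\<exists>(n::nat) (X :: point topology) (\<A> :: point chart set)
            (Y :: point topology) (\<B> :: point chart set).
           topological_symplectic_manifold n X \<A> \<and>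
           topological_symplectic_manifold n Y \<B> \<and>
           X homeomorphic_space Y \<and>
           \<not> symplectically_homeomorphic n X \<A> Y \<B>"
proof -
  \<comment> \<open>The area inequality bounds the source by the target, so the set of infinite area
    is taken as source and the disc as target.\<close>
  define U where "U = plane_embed ` UNIV"
  define V where "V = plane_embed ` ball 0 1"
  let ?X = "subtopology (Euclidean_space (2 * 1)) U"
  let ?Y = "subtopology (Euclidean_space (2 * 1)) V"
  have "openin (Euclidean_space 2) (plane_embed ` S)" if "open S" for S
    using homeomorphic_map_openness[OF homeomorphic_map_plane] that by simp
  then have U: "openin (Euclidean_space (2 * 1)) U" and V: "openin (Euclidean_space (2 * 1)) V"
    by (simp_all add: U_def V_def)
  have sub: "top_of_set S homeomorphic_space subtopology (Euclidean_space (2 * 1)) (plane_embed ` S)" for S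
  proof -
    have "homeomorphic_map (top_of_set S) (subtopology (Euclidean_space 2) (plane_embed ` S)) plane_embed"
      by (rule homeomorphic_map_subtopologies[OF homeomorphic_map_plane]) auto
    then show ?thesis by (auto simp: homeomorphic_map_imp_homeomorphic_space)
  qed
  have "(UNIV :: (real^2) set) homeomorphic ball (0 :: real^2) 1"
    using homeomorphic_ball_UNIV homeomorphic_sym zero_less_one by blast
  then have "top_of_set (UNIV :: (real^2) set) homeomorphic_space top_of_set (ball (0 :: real^2) 1)"
    by (auto simp: homeomorphic_def homeomorphism_def homeomorphic_space_def homeomorphic_maps_def
        continuous_map_in_subtopology)
  then have "?X homeomorphic_space ?Y"
    unfolding U_def V_def
    using homeomorphic_space_trans[OF iffD1[OF homeomorphic_space_sym sub]
        homeomorphic_space_trans[OF _ sub]] by blast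
  moreover have "\<not> symplectically_homeomorphic 1 ?X {(U, id)} ?Y {(V, id)}"
  proof
    assume "symplectically_homeomorphic 1 ?X {(U, id)} ?Y {(V, id)}"
    then obtain f where "symplectic_homeo 1 U V f"
      using symplectically_homeomorphic_open_imp_symplectic_homeo[OF U V] by blast
    then have "emeasure lebesgue (plane_embed -` U) \<le> emeasure lebesgue (plane_embed -` V)"
      by (rule symplectic_homeo_emeasure_le)
    moreover have "inj plane_embed"
      by (metis injI plane_proj_embed)
    ultimately have "emeasure lebesgue (UNIV :: (real^2) set) \<le> emeasure lebesgue (ball (0 :: real^2) 1)"
      by (simp add: U_def V_def inj_vimage_image_eq)
    then show False
      using emeasure_lborel_ball_finite[of "0 :: real^2" 1] by (simp add: top_unique)
  qed
  ultimately show ?thesis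
    using topological_symplectic_manifold_open[OF U] topological_symplectic_manifold_open[OF V]
    by (intro exI[of _ 1] exI[of _ ?X] exI[of _ ?Y] exI[of _ "{(U, id)}"] exI[of _ "{(V, id)}"] conjI)
qed

end
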